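(* For all $i\ge 1$, $j\ge 0$, the limits $$\lim_{n\to\infty}\tau_n(i,j)=\tau(i,j),\qquad \lim_{n\to\infty}\delta_n(i,j)=\delta(i,j)$$ exist, and $\tau(i,j)=\tau_{f^*}(i,j)$, where $f^*$ is the decision function defined by $$f^*(i,j)=B\Leftrightarrow \delta(i,j)=(i+1,j),\qquad f^*(i,j)=I\Leftrightarrow \delta(i,j)=(i,j+1).$$ Moreover $f^*$ is an individually optimal decision function.
   Context: Let $0<\lambda<\mu$ and costs $c>0$, $d\ge 0$. Interpretation: in a two-queue polling system with Poisson($\lambda$) arrivals, exponential($\mu$) services, exhaustive service and no switch-over times, the state $(i,j)$ means $i$ customers in the busy queue (where the server is) and $j$ in the idle queue; waiting costs $c$ per unit time in the busy queue and $d$ per unit time in the idle queue. Decision functions: a decision function $f$ assigns to each state $(i,j)$, $i\ge 1$, $j\ge 0$, a value $f(i,j)\in\{I,B\}$; $f(i,j)=B$ (resp. $I$) means that a customer arriving in state $(i,j)$ joins the busy (resp. idle) queue. $\tau_f(i,j)$ is the expected time until the busy queue empties when starting from $i$ customers in the busy queue and $j$ in the idle queue under $f$; i.e. the expected hitting time of $\{(0,j'):j'\ge 0\}$ for the continuous-time Markov chain that from $(i,j)$ with $i\ge1$ jumps at rate $\mu$ to $(i-1,j)$ and at rate $\lambda$ to $(i+1,j)$ if $f(i,j)=B$ or to $(i,j+1)$ if $f(i,j)=I$. It satisfies $\tau_f(i,j)\le i/(\mu-\lambda)$. A decision function $f$ is individually optimal if for all $i\ge 1$, $j\ge 0$: $f(i,j)=B\Leftrightarrow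 \frac{ci}{\mu}<d\,\tau_{f}(i,j+1)+\frac{cj}{\mu}$ (and hence $f(i,j)=I\Leftrightarrow \frac{ci}{\mu}\ge d\,\tau_{f}(i,j+1)+\frac{cj}{\mu}$). Recursion: put $\tau_0(i,j)=i/\mu$ for $i\ge 1,j\ge 0$, and $\tau_n(0,j)=0$ for all $n,j\ge0$. For all $n\ge 0$, $i\ge 1$, $j\ge 0$ define $$\delta_n(i,j)=\begin{cases}(i+1,j) & \text{if } ci/\mu<d\,\tau_n(i,j+1)+cj/\mu,\\ (i,j+1) & \text{if } ci/\mu\ge d\,\tau_n(i,j+1)+cj/\mu,\end{cases}$$ $$\tau_{n+1}(i,j)=\frac{1}{\lambda+\mu}+\frac{\mu}{\lambda+\mu}\tau_n(i-1,j)+\frac{\lambda}{\lambda+\mu}\tau_n(\delta_n(i,j)).$$ Convergence of $\delta_n(i,j)$ (a sequence in a discrete set) means it is eventually constant. *)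

theory Defs
  imports "HOL-Probability.Probability"
begin

datatype queue = Busy | Idle

text \<open>
  Rates: \<open>l\<close> is the arrival rate and \<open>m\<close> the service rate. A decision function has type
  \<open>nat \<Rightarrow> nat \<Rightarrow> queue\<close>; its values at states \<open>(0, j)\<close> play no role, as these states are
  absorbing below.

  The continuous-time chain is built from its embedded jump chain and its holding times. In each
  sojourn an independent pair of clocks runs: a service clock with law \<open>Exp(m)\<close> (first component)
  and an arrival clock with law \<open>Exp(l)\<close> (second component). The chain jumps when the first of
  them rings. The clocks can be renewed at every jump because of the memoryless property.
\<close>

definition exponential :: "real \<Rightarrow> real measure" where
  "exponential r = density lborel (\<lambda>x. ennreal (exponential_density r x))"

definition clocks :: "real \<Rightarrow> real \<Rightarrow> (real \<times> real) stream measure" where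
  "clocks l m = stream_space (exponential m \<Otimes>\<^sub>M exponential l)"

definition jump :: "(nat \<Rightarrow> nat \<Rightarrow> queue) \<Rightarrow> real \<times> real \<Rightarrow> nat \<times> nat \<Rightarrow> nat \<times> nat" where
  "jump f = (\<lambda>(service, arrival) (i, j).
     if i = 0 then (0, j)
     else if service \<le> arrival then (i - 1, j)
     else (case f i j of Busy \<Rightarrow> (i + 1, j) | Idle \<Rightarrow> (i, j + 1)))"

primrec jump_chain ::
    "(nat \<Rightarrow> nat \<Rightarrow> queue) \<Rightarrow> nat \<times> nat \<Rightarrow> (real \<times> real) stream \<Rightarrow> nat \<Rightarrow> nat \<times> nat" where
  "jump_chain f s \<omega> 0 = s"
| "jump_chain f s \<omega> (Suc n) = jump f (\<omega> !! n) (jump_chain f s \<omega> n)"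

definition jump_time :: "(real \<times> real) stream \<Rightarrow> nat \<Rightarrow> real" where
  "jump_time \<omega> n = (\<Sum>k<n. min (fst (\<omega> !! k)) (snd (\<omega> !! k)))"

text \<open>
  The jump times are almost surely increasing, so the infimum is the time of the first jump into
  \<open>{(0, j') | j'}\<close>; it is \<open>\<infinity>\<close> if that set is never reached.
\<close>

definition emptying_time ::
    "(nat \<Rightarrow> nat \<Rightarrow> queue) \<Rightarrow> nat \<Rightarrow> nat \<Rightarrow> (real \<times> real) stream \<Rightarrow> ennreal" where
  "emptying_time f i j \<omega> =
     (INF n\<in>{n. fst (jump_chain f (i, j) \<omega> n) = 0}. ennreal (jump_time \<omega> n))"

definition expected_emptying_time ::
    "real \<Rightarrow> real \<Rightarrow> (nat \<Rightarrow> nat \<Rightarrow> queue) \<Rightarrow> nat \<Rightarrow> nat \<Rightarrow> ennreal" where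
  "expected_emptying_time l m f i j = (\<integral>\<^sup>+ \<omega>. emptying_time f i j \<omega> \<partial>clocks l m)"

definition individually_optimal ::
    "real \<Rightarrow> real \<Rightarrow> real \<Rightarrow> real \<Rightarrow> (nat \<Rightarrow> nat \<Rightarrow> queue) \<Rightarrow> bool" where
  "individually_optimal l m c d f \<longleftrightarrow>
     (\<forall>i\<ge>1. \<forall>j. f i j = Busy \<longleftrightarrow>
        ennreal (c * real i / m)
          < ennreal d * expected_emptying_time l m f i (j + 1) + ennreal (c * real j / m))"

definition best_move ::
    "real \<Rightarrow> real \<Rightarrow> real \<Rightarrow> (nat \<Rightarrow> nat \<Rightarrow> real) \<Rightarrow> nat \<Rightarrow> nat \<Rightarrow> nat \<times> nat" where
  "best_move m c d t i j =
     (if c * real i / m < d * t i (j + 1) + c * real j / m then (i + 1, j) else (i, j + 1))"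

primrec tau_iter ::
    "real \<Rightarrow> real \<Rightarrow> real \<Rightarrow> real \<Rightarrow> nat \<Rightarrow> nat \<Rightarrow> nat \<Rightarrow> real" where
  "tau_iter l m c d 0 = (\<lambda>i j. real i / m)"
| "tau_iter l m c d (Suc n) = (\<lambda>i j.
     if i = 0 then 0
     else 1 / (l + m) + m / (l + m) * tau_iter l m c d n (i - 1) j
        + l / (l + m) * case_prod (tau_iter l m c d n) (best_move m c d (tau_iter l m c d n) i j))"

definition delta_iter ::
    "real \<Rightarrow> real \<Rightarrow> real \<Rightarrow> real \<Rightarrow> nat \<Rightarrow> nat \<Rightarrow> nat \<Rightarrow> nat \<times> nat" where
  "delta_iter l m c d n = best_move m c d (tau_iter l m c d n)"

end

theory Submission
  imports Defs
begin

text \<open>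
  Whatever the decisions are, moving a customer from the idle to the busy queue does not decrease
  the iterates. Hence they increase with \<open>n\<close>; they stay below \<open>i / (m - l)\<close>, so they converge. The
  condition for joining the busy queue is monotone in the iterates, and as a strict inequality it
  passes from an iterate to the limit while its negation passes to limits, so the decisions are
  eventually constant and the limit solves the first-step equations of the limit policy. A linearly
  bounded solution of these equations is unique, because the jump chain killed at an empty busy queue
  contracts a geometric weight; truncating after \<open>n\<close> jumps and letting \<open>n\<close> grow identifies the
  solution with the expected emptying time.
\<close>

section \<open>Exponential laws\<close>

lemma sets_exponential [measurable_cong]: "sets (exponential r) = sets borel"
  by (simp add: exponential_def)

lemma space_exponential [simp]: "space (exponential r) = UNIV"
  by (simp add: exponential_def)

lemma prob_space_exponential: "0 < r \<Longrightarrow> prob_space (exponential r)"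
  unfolding exponential_def by (rule prob_space_exponential_density)

lemma distributed_exponential:
  "distributed (exponential r) lborel (\<lambda>x. x) (exponential_density r)"
  unfolding distributed_def exponential_def
  by (auto simp: distr_id2 measurable_ident_sets)

lemma emeasure_exponential_gt:
  assumes "0 < r" "0 \<le> y"
  shows "emeasure (exponential r) {y<..} = ennreal (exp (- y * r))"
proof -
  interpret prob_space "exponential r" by (rule prob_space_exponential) fact
  show ?thesis
    using exponential_distributedD_gt[OF distributed_exponential assms(2,1)]
    by (simp add: emeasure_eq_measure greaterThan_def)
qed

lemma AE_exponential_nonneg: "0 < r \<Longrightarrow> AE x in exponential r. 0 \<le> x"
  unfolding exponential_def
  by (subst AE_density) (auto simp: exponential_density_def not_less)

section \<open>The jump chain and rewards collected along it\<close>

definition arrival_move :: "(nat \<Rightarrow> nat \<Rightarrow> queue) \<Rightarrow> nat \<Rightarrow> nat \<Rightarrow> nat \<times> nat" where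
  "arrival_move f i j = (case f i j of Busy \<Rightarrow> (i + 1, j) | Idle \<Rightarrow> (i, j + 1))"

lemma arrival_move_cases:
  obtains "arrival_move f i j = (i + 1, j)" | "arrival_move f i j = (i, j + 1)"
  by (cases "f i j") (auto simp: arrival_move_def)

lemma jump_pos:
  "0 < i \<Longrightarrow> jump f x (i, j) = (if fst x \<le> snd x then (i - 1, j) else arrival_move f i j)"
  by (simp add: jump_def arrival_move_def split: prod.split)

lemma jump_zero [simp]: "jump f x (0, j) = (0, j)"
  by (simp add: jump_def split: prod.split)

lemma fst_jump_zero: "fst s = 0 \<Longrightarrow> jump f x s = s"
  by (cases s) simp

lemma jump_chain_absorbed:
  assumes "k \<le> n" and "fst (jump_chain f s \<omega> k) = 0"
  shows "jump_chain f s \<omega> n = jump_chain f s \<omega> k"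
  using assms by (induction rule: dec_induct) (auto simp: fst_jump_zero)

text \<open>The defining recursion splits off the last jump; first-step analysis has to split off
  the first one.\<close>

lemma jump_chain_Stream:
  "jump_chain f s (x ## \<omega>) (Suc n) = jump_chain f (jump f x s) \<omega> n"
  by (induction n) auto

text \<open>
  \<open>(a, b) = (1, 0)\<close> gives the emptying time truncated after \<open>n\<close> jumps, and \<open>(a, b) = (0, 1)\<close> the
  indicator of not being absorbed by then.
\<close>

definition reward ::
    "real \<Rightarrow> real \<Rightarrow> (nat \<Rightarrow> nat \<Rightarrow> queue) \<Rightarrow> nat \<Rightarrow> nat \<times> nat \<Rightarrow> (real \<times> real) stream \<Rightarrow> ennreal" where
  "reward a b f n s \<omega> =
     (\<Sum>k<n. if fst (jump_chain f s \<omega> k) = 0 then 0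
             else ennreal a * ennreal (min (fst (\<omega> !! k)) (snd (\<omega> !! k))))
     + (if fst (jump_chain f s \<omega> n) = 0 then 0 else ennreal b)"

text \<open>The first-step recursion that \<open>nn_integral_reward\<close> proves for the mean of
  \<open>reward\<close>. It is real-valued because it is later subtracted from a candidate
  solution.\<close>

primrec expected_reward ::
    "real \<Rightarrow> real \<Rightarrow> real \<Rightarrow> real \<Rightarrow> (nat \<Rightarrow> nat \<Rightarrow> queue) \<Rightarrow> nat \<Rightarrow> nat \<Rightarrow> nat \<Rightarrow> real" where
  "expected_reward l m a b f 0 = (\<lambda>i j. if i = 0 then 0 else b)"
| "expected_reward l m a b f (Suc n) = (\<lambda>i j. if i = 0 then 0
     else a / (l + m) + m / (l + m) * expected_reward l m a b f n (i - 1) j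
        + l / (l + m) * case_prod (expected_reward l m a b f n) (arrival_move f i j))"

declare tau_iter.simps(2) [simp del] expected_reward.simps(2) [simp del]

lemma expected_reward_zero [simp]: "expected_reward l m a b f n 0 j = 0"
  by (cases n) (simp_all add: expected_reward.simps(2))

lemma expected_reward_step:
  "0 < i \<Longrightarrow> expected_reward l m a b f (Suc n) i j
    = a / (l + m) + m / (l + m) * expected_reward l m a b f n (i - 1) j
      + l / (l + m) * case_prod (expected_reward l m a b f n) (arrival_move f i j)"
  by (simp add: expected_reward.simps(2))

lemma reward_absorbed: "fst s = 0 \<Longrightarrow> reward a b f n s \<omega> = 0"
  using jump_chain_absorbed[of 0 _ f s \<omega>] by (simp add: reward_def)

lemma reward_Stream:
  assumes "fst s \<noteq> 0"
  shows "reward a b f (Suc n) s (x ## \<omega>) =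
    ennreal a * ennreal (min (fst x) (snd x)) + reward a b f n (jump f x s) \<omega>"
  using assms unfolding reward_def
  by (subst sum.lessThan_Suc_shift) (simp add: jump_chain_Stream add.assoc del: jump_chain.simps(2) cong: if_cong)

section \<open>The law of a single sojourn\<close>

locale stable_queue =
  fixes l m :: real
  assumes arrival_pos: "0 < l" and arrival_less_service: "l < m"
begin

lemma service_pos: "0 < m"
  using arrival_pos arrival_less_service by simp

definition clock_pair :: "(real \<times> real) measure" where
  "clock_pair = exponential m \<Otimes>\<^sub>M exponential l"

sublocale service: prob_space "exponential m"
  by (rule prob_space_exponential[OF service_pos])

sublocale arrival: prob_space "exponential l"
  by (rule prob_space_exponential[OF arrival_pos])

sublocale pair_prob_space "exponential m" "exponential l" ..

sublocale clock_pair: prob_space clock_pair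
  unfolding clock_pair_def by (rule prob_space_axioms)

lemma sets_clock_pair [measurable_cong]: "sets clock_pair = sets (borel \<Otimes>\<^sub>M borel)"
  unfolding clock_pair_def by (intro sets_pair_measure_cong sets_exponential)

lemma space_clock_pair [simp]: "space clock_pair = UNIV"
  by (simp add: clock_pair_def space_pair_measure)

lemma clocks_eq: "clocks l m = stream_space clock_pair"
  by (simp add: clocks_def clock_pair_def)

sublocale clocks: prob_space "clocks l m"
  unfolding clocks_eq by (rule clock_pair.prob_space_stream_space)

lemma AE_clock_pair_nonneg: "AE x in clock_pair. 0 \<le> fst x \<and> 0 \<le> snd x"
proof -
  have "AE x in exponential m. AE y in exponential l. 0 \<le> x \<and> 0 \<le> y"
    using AE_exponential_nonneg[OF service_pos] AE_exponential_nonneg[OF arrival_pos] by auto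
  then have "AE x in clock_pair. case_prod (\<lambda>x y. 0 \<le> x \<and> 0 \<le> y) x"
    unfolding clock_pair_def by (intro AE_pair_measure) auto
  then show ?thesis
    by (auto simp: case_prod_beta)
qed

lemma sets_arrival_first: "{x. snd x < fst x} \<in> sets clock_pair"
  unfolding sets_clock_pair borel_prod by (intro borel_open open_Collect_less continuous_intros)

lemma sets_service_first: "{x. fst x \<le> snd x} \<in> sets clock_pair"
  unfolding sets_clock_pair borel_prod by (intro borel_closed closed_Collect_le continuous_intros)

text \<open>Given that the arrival clock shows \<open>y\<close>, the service clock exceeds it with
  probability \<open>exp (- y * m)\<close>. Times the density of the arrival clock, this is
  \<open>l / (l + m)\<close> times the density of an exponential law of rate \<open>l + m\<close>,
  whose total mass is \<open>1\<close>.\<close>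

lemma prob_arrival_first: "emeasure clock_pair {x. snd x < fst x} = ennreal (l / (l + m))"
proof -
  have A: "{x. snd x < fst x} \<in> sets (exponential m \<Otimes>\<^sub>M exponential l)"
    using sets_arrival_first unfolding clock_pair_def .
  have "emeasure clock_pair {x. snd x < fst x}
      = (\<integral>\<^sup>+ y. emeasure (exponential m) {y<..} \<partial>exponential l)"
    unfolding clock_pair_def
    by (subst emeasure_pair_measure_alt2[OF A])
       (auto intro!: nn_integral_cong arg_cong[where f="emeasure _"])
  also have "\<dots> = (\<integral>\<^sup>+ y. ennreal (exp (- y * m)) \<partial>exponential l)"
    using AE_exponential_nonneg[OF arrival_pos]
    by (intro nn_integral_cong_AE) (auto simp: emeasure_exponential_gt[OF service_pos])
  also have "\<dots> = (\<integral>\<^sup>+ y. ennreal (exponential_density l y) * ennreal (exp (- y * m)) \<partial>lborel)"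
    unfolding exponential_def by (subst nn_integral_density) auto
  also have "\<dots> = (\<integral>\<^sup>+ y. ennreal (l / (l + m)) * ennreal (exponential_density (l + m) y) \<partial>lborel)"
    using arrival_pos service_pos
    by (intro nn_integral_cong)
       (auto simp: ennreal_mult'[symmetric] exponential_density_def exp_add[symmetric] field_simps)
  also have "\<dots> = ennreal (l / (l + m)) * emeasure (exponential (l + m)) UNIV"
    by (subst nn_integral_cmult) (auto simp: exponential_def emeasure_density)
  also have "\<dots> = ennreal (l / (l + m))"
    using prob_space.emeasure_space_1[OF prob_space_exponential, of "l + m"] arrival_pos service_pos
    by simp
  finally show ?thesis .
qed

text \<open>Ties count as services, as in \<open>jump\<close>, so this event is exactly the
  complement of the previous one.\<close>

lemma prob_service_first: "emeasure clock_pair {x. fst x \<le> snd x} = ennreal (m / (l + m))"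
proof -
  have "emeasure clock_pair {x. fst x \<le> snd x} = emeasure clock_pair (space clock_pair - {x. snd x < fst x})"
    by (intro arg_cong[where f="emeasure _"]) auto
  also have "\<dots> = 1 - ennreal (l / (l + m))"
    by (subst emeasure_compl)
       (simp_all add: sets_arrival_first prob_arrival_first clock_pair.emeasure_space_1[simplified])
  also have "\<dots> = ennreal (m / (l + m))"
    using arrival_pos service_pos
    by (simp add: ennreal_1[symmetric] ennreal_minus field_simps del: ennreal_1)
  finally show ?thesis .
qed

text \<open>The minimum exceeds \<open>a\<close> exactly on a square, where independence multiplies
  the two exponential tails.\<close>

lemma distributed_sojourn:
  "distributed clock_pair lborel (\<lambda>x. min (fst x) (snd x)) (exponential_density (m + l))"
proof (rule exponential_distributedI)
  fix a :: real assume a: "0 \<le> a"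
  have A: "{a<..} \<times> {a<..} \<in> sets clock_pair"
    unfolding sets_clock_pair by measurable
  have "emeasure clock_pair {x \<in> space clock_pair. min (fst x) (snd x) \<le> a}
      = emeasure clock_pair (space clock_pair - {a<..} \<times> {a<..})"
    by (intro arg_cong[where f="emeasure _"]) auto
  also have "\<dots> = 1 - emeasure clock_pair ({a<..} \<times> {a<..})"
    using A by (subst emeasure_compl) (simp_all add: clock_pair.emeasure_space_1[simplified])
  also have "emeasure clock_pair ({a<..} \<times> {a<..}) = ennreal (exp (- a * (m + l)))"
    unfolding clock_pair_def
    using emeasure_exponential_gt[OF service_pos a] emeasure_exponential_gt[OF arrival_pos a]
    by (subst arrival.emeasure_pair_measure_Times)
       (auto simp: sets_exponential ennreal_mult'[symmetric] exp_add[symmetric] algebra_simps)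
  finally show "emeasure clock_pair {x \<in> space clock_pair. min (fst x) (snd x) \<le> a}
      = 1 - ennreal (exp (- a * (m + l)))" .
qed (use arrival_pos service_pos in \<open>simp_all\<close>)

lemma expected_sojourn:
  "(\<integral>\<^sup>+ x. ennreal (min (fst x) (snd x)) \<partial>clock_pair) = ennreal (1 / (l + m))"
proof -
  from distributed_nn_integral[OF distributed_sojourn, of ennreal]
  have "(\<integral>\<^sup>+ x. ennreal (min (fst x) (snd x)) \<partial>clock_pair)
      = (\<integral>\<^sup>+ y. ennreal (exponential_density (m + l) y) * ennreal y \<partial>lborel)"
    by simp
  \<comment> \<open>An exponential law is the Erlang law with index \<open>0\<close>, so its mean is
    a first Erlang moment. The density vanishes for negative \<open>y\<close>, where
    \<open>ennreal y\<close> is \<open>0\<close>.\<close>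
  also have "\<dots> = (\<integral>\<^sup>+ y. ennreal (erlang_density 0 (m + l) y * y ^ 1) \<partial>lborel)"
    using arrival_pos service_pos
    by (intro nn_integral_cong) (auto simp: erlang_density_def ennreal_mult' ennreal_neg)
  also have "\<dots> = ennreal (1 / (l + m))"
    using arrival_pos service_pos
    by (subst nn_integral_erlang_ith_moment) (auto simp: add.commute)
  finally show ?thesis .
qed

section \<open>Measurability and expectation of rewards\<close>

lemma first_step_mono:
  "x \<le> x' \<Longrightarrow> y \<le> y' \<Longrightarrow> e + m / (l + m) * x + l / (l + m) * y \<le> e + m / (l + m) * x' + l / (l + m) * y'"
  using arrival_pos service_pos by (intro add_mono mult_left_mono) auto

lemma measurable_jump [measurable]: "(\<lambda>x. jump f x s) \<in> clock_pair \<rightarrow>\<^sub>M count_space UNIV"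
proof -
  obtain i j where s: "s = (i, j)" by fastforce
  have [measurable]: "Measurable.pred clock_pair (\<lambda>x. fst x \<le> snd x)"
    using sets_service_first by (simp add: pred_def)
  show ?thesis
    by (cases "i = 0") (simp_all add: s jump_pos)
qed

lemma measurable_jump_chain [measurable]:
  "(\<lambda>\<omega>. jump_chain f s \<omega> n) \<in> clocks l m \<rightarrow>\<^sub>M count_space UNIV"
proof (induction n)
  case (Suc n)
  have "(\<lambda>\<omega>. jump f (\<omega> !! n) t) \<in> clocks l m \<rightarrow>\<^sub>M count_space UNIV" for t
    unfolding clocks_eq by measurable
  \<comment> \<open>There are countably many states, so the state before the jump may be treated as
    a fixed parameter \<open>t\<close>.\<close>
  from measurable_compose_countable[OF this Suc] show ?case
    by simp
qed simp

lemma measurable_sojourn [measurable]: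
  "(\<lambda>\<omega>. min (fst (\<omega> !! k)) (snd (\<omega> !! k))) \<in> borel_measurable (clocks l m)"
  unfolding clocks_eq by measurable

lemma measurable_reward [measurable]: "reward a b f n s \<in> borel_measurable (clocks l m)"
  unfolding reward_def[abs_def] by measurable

lemma expected_reward_nonneg:
  "0 \<le> a \<Longrightarrow> 0 \<le> b \<Longrightarrow> 0 \<le> expected_reward l m a b f n i j"
  using arrival_pos service_pos
  by (induction n arbitrary: i j) (auto simp: expected_reward.simps(2) split: prod.split)

lemma nn_integral_jump:
  assumes "0 < i"
  shows "(\<integral>\<^sup>+ x. G (jump f x (i, j)) \<partial>clock_pair)
    = ennreal (m / (l + m)) * G (i - 1, j) + ennreal (l / (l + m)) * G (arrival_move f i j)"
proof -
  note sets_arrival_first [measurable] sets_service_first [measurable]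
  have "(\<integral>\<^sup>+ x. G (jump f x (i, j)) \<partial>clock_pair)
    = (\<integral>\<^sup>+ x. G (i - 1, j) * indicator {x. fst x \<le> snd x} x
          + G (arrival_move f i j) * indicator {x. snd x < fst x} x \<partial>clock_pair)"
    using assms by (intro nn_integral_cong) (auto simp: jump_pos split: split_indicator)
  also have "\<dots> = ennreal (m / (l + m)) * G (i - 1, j) + ennreal (l / (l + m)) * G (arrival_move f i j)"
    by (subst nn_integral_add)
       (auto simp: nn_integral_cmult_indicator prob_arrival_first prob_service_first mult.commute)
  finally show ?thesis .
qed

text \<open>First-step analysis: the stream measure splits into the first pair of clocks and an
  independent stream of the same law. Linearity separates the first sojourn, of mean
  \<open>1 / (l + m)\<close>, from the reward of the chain restarted after the first jump.\<close>

lemma nn_integral_reward: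
  assumes "0 \<le> a" "0 \<le> b"
  shows "(\<integral>\<^sup>+ \<omega>. reward a b f n (i, j) \<omega> \<partial>clocks l m) = ennreal (expected_reward l m a b f n i j)"
proof (induction n arbitrary: i j)
  case 0
  then show ?case
    by (simp add: reward_def clocks.emeasure_space_1)
next
  case (Suc n)
  show ?case
  proof (cases "i = 0")
    case True
    then show ?thesis by (simp add: reward_absorbed)
  next
    case False
    let ?G = "\<lambda>s. \<integral>\<^sup>+ \<omega>. reward a b f n s \<omega> \<partial>clocks l m"
    have G: "?G s = ennreal (case_prod (expected_reward l m a b f n) s)" for s
      by (cases s) (simp add: Suc)
    have G_nonneg: "0 \<le> case_prod (expected_reward l m a b f n) s" for s
      using expected_reward_nonneg[OF assms] by (cases s) simp
    have [measurable]: "(\<lambda>x. ?G (jump f x (i, j))) \<in> borel_measurable clock_pair"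
      by (rule measurable_compose[OF measurable_jump]) simp
    have [measurable]: "(\<lambda>x. min (fst x) (snd x)) \<in> borel_measurable clock_pair"
      by measurable
    have "(\<integral>\<^sup>+ \<omega>. reward a b f (Suc n) (i, j) \<omega> \<partial>clocks l m)
        = (\<integral>\<^sup>+ x. \<integral>\<^sup>+ \<omega>. reward a b f (Suc n) (i, j) (x ## \<omega>) \<partial>clocks l m \<partial>clock_pair)"
      using measurable_reward unfolding clocks_eq by (rule clock_pair.nn_integral_stream_space)
    also have "\<dots> = (\<integral>\<^sup>+ x. ennreal a * ennreal (min (fst x) (snd x)) + ?G (jump f x (i, j)) \<partial>clock_pair)"
      using False
      by (simp add: reward_Stream nn_integral_add clocks.emeasure_space_1)
    also have "\<dots> = ennreal a * ennreal (1 / (l + m)) + (\<integral>\<^sup>+ x. ?G (jump f x (i, j)) \<partial>clock_pair)"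
      by (subst nn_integral_add) (simp_all add: nn_integral_cmult expected_sojourn)
    also have "\<dots> = ennreal a * ennreal (1 / (l + m))
        + (ennreal (m / (l + m)) * ?G (i - 1, j) + ennreal (l / (l + m)) * ?G (arrival_move f i j))"
      using False by (subst nn_integral_jump) simp_all
    also have "\<dots> = ennreal (expected_reward l m a b f (Suc n) i j)"
      unfolding G using False assms arrival_pos service_pos
      by (simp add: expected_reward_step ennreal_mult'[symmetric] ennreal_plus[symmetric] G_nonneg
          expected_reward_nonneg add.assoc del: ennreal_plus)
    finally show ?thesis .
  qed
qed

text \<open>
  Any \<open>r\<close> strictly between \<open>1\<close> and \<open>m / l\<close> makes \<open>r ^ i\<close> a strict supersolution of the absorbed
  walk: the factor \<open>\<rho>\<close> is below \<open>1\<close> because \<open>(r - 1) * (l * r - m) < 0\<close>.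
\<close>

lemma absorbed_walk_vanishes:
  fixes e :: "nat \<Rightarrow> nat \<Rightarrow> nat \<Rightarrow> real"
  assumes nonneg: "\<And>n i j. 0 \<le> e n i j"
    and absorbed: "\<And>n j. e n 0 j = 0"
    and step: "\<And>n i j. 0 < i \<Longrightarrow> e (Suc n) i j
      = m / (l + m) * e n (i - 1) j + l / (l + m) * case_prod (e n) (arrival_move f i j)"
    and linear: "\<And>i j. e 0 i j \<le> C * real i" and "0 \<le> C"
  shows "(\<lambda>n. e n i j) \<longlonglongrightarrow> 0"
proof -
  \<comment> \<open>The midpoint of \<open>1\<close> and \<open>m / l\<close>.\<close>
  define r where "r = (1 + m / l) / 2"
  define \<rho> where "\<rho> = (m / r + l * r) / (l + m)"
  \<comment> \<open>Bernoulli's inequality gives \<open>i * (r - 1) \<le> r ^ i\<close>, so with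
    this \<open>D\<close> the linear bound \<open>C * i\<close> is at most
    \<open>D * r ^ i\<close>.\<close>
  define D where "D = C / (r - 1)"
  have r: "1 < r" "l * r < m"
    using arrival_pos arrival_less_service by (auto simp: r_def field_simps)
  have "0 < (r - 1) * (m - l * r)"
    using r by (intro mult_pos_pos) auto
  then have "m / r + l * r < l + m"
    using r by (simp add: field_simps)
  then have \<rho>: "0 \<le> \<rho>" "\<rho> < 1"
    using arrival_pos service_pos r by (auto simp: \<rho>_def)
  have "0 \<le> D"
    using r \<open>0 \<le> C\<close> by (simp add: D_def)
  have bound: "e n i j \<le> D * \<rho> ^ n * r ^ i" for n i j
  proof (induction n arbitrary: i j)
    case 0
    have "1 + real i * (r - 1) \<le> (1 + (r - 1)) ^ i"
      using r by (intro Bernoulli_inequality) auto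
    then have "real i * (r - 1) \<le> r ^ i"
      by simp
    then have "D * (real i * (r - 1)) \<le> D * r ^ i"
      using \<open>0 \<le> D\<close> by (rule mult_left_mono)
    then show ?case
      using linear[of i j] r by (simp add: D_def)
  next
    case (Suc n)
    show ?case
    proof (cases "i = 0")
      case True
      then show ?thesis
        using \<open>0 \<le> D\<close> \<rho> by (simp add: absorbed)
    next
      case False
      then obtain k where k: "i = Suc k" by (cases i) auto
      \<comment> \<open>Joining the idle queue keeps \<open>i\<close>; weakening its bound to the
        weight of \<open>i + 1\<close> covers both decisions at once.\<close>
      have "e n i (j + 1) \<le> D * \<rho> ^ n * r ^ i"
        by (rule Suc)
      also have "\<dots> \<le> D * \<rho> ^ n * r ^ (i + 1)"
        using r \<rho> \<open>0 \<le> D\<close> by (intro mult_left_mono power_increasing) auto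
      finally have "case_prod (e n) (arrival_move f i j) \<le> D * \<rho> ^ n * r ^ (i + 1)"
        using Suc[of "i + 1" j] by (cases rule: arrival_move_cases[of f i j]) auto
      from first_step_mono[OF Suc[of "i - 1" j] this, where e = 0]
      have "e (Suc n) i j \<le> m / (l + m) * (D * \<rho> ^ n * r ^ (i - 1))
          + l / (l + m) * (D * \<rho> ^ n * r ^ (i + 1))"
        using False by (simp only: step neq0_conv add_0)
      also have "\<dots> = D * \<rho> ^ n * r ^ k * (m / (l + m) + l / (l + m) * (r * r))"
        by (simp add: k algebra_simps)
      also have "m / (l + m) + l / (l + m) * (r * r) = \<rho> * r"
        using r by (simp add: \<rho>_def add_divide_distrib distrib_right)
      also have "D * \<rho> ^ n * r ^ k * (\<rho> * r) = D * \<rho> ^ Suc n * r ^ i"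
        by (simp add: k)
      finally show ?thesis .
    qed
  qed
  have "(\<lambda>n. D * \<rho> ^ n * r ^ i) \<longlonglongrightarrow> D * 0 * r ^ i"
    using \<rho> by (intro tendsto_intros LIMSEQ_realpow_zero)
  then have "(\<lambda>n. D * \<rho> ^ n * r ^ i) \<longlonglongrightarrow> 0"
    by simp
  then show ?thesis
    by (rule tendsto_sandwich[where f = "\<lambda>_. 0", rotated 3])
       (simp_all add: nonneg bound)
qed

section \<open>Almost sure absorption and the expected emptying time\<close>

lemma AE_clocks_nonneg: "AE \<omega> in clocks l m. \<forall>k. 0 \<le> min (fst (\<omega> !! k)) (snd (\<omega> !! k))"
proof -
  have [measurable]: "Measurable.pred clock_pair (\<lambda>x. 0 \<le> fst x \<and> 0 \<le> snd x)"
    by measurable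
  show ?thesis
    using clock_pair.AE_stream_all[OF _ AE_clock_pair_nonneg] unfolding clocks_eq
    by (auto elim!: eventually_mono)
qed

text \<open>The probability of surviving \<open>n\<close> jumps is \<open>expected_reward\<close>
  with \<open>(a, b) = (0, 1)\<close>. It tends to \<open>0\<close> and bounds the probability of
  never being absorbed.\<close>

lemma AE_absorbed: "AE \<omega> in clocks l m. \<exists>n. fst (jump_chain f (i, j) \<omega> n) = 0"
proof -
  have vanish: "(\<lambda>n. expected_reward l m 0 1 f n i j) \<longlonglongrightarrow> 0"
  proof (rule absorbed_walk_vanishes[where f = f and C = 1])
  qed (auto simp: expected_reward_nonneg expected_reward_step)
  define N where "N = {\<omega> \<in> space (clocks l m). \<forall>n. fst (jump_chain f (i, j) \<omega> n) \<noteq> 0}"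
  have [measurable]: "N \<in> sets (clocks l m)"
    unfolding N_def by measurable
  have alive: "1 \<le> reward 0 1 f n (i, j) \<omega>" if "\<omega> \<in> N" for n \<omega>
  proof -
    have "fst (jump_chain f (i, j) \<omega> n) \<noteq> 0"
      using that by (simp add: N_def)
    then show ?thesis by (simp add: reward_def)
  qed
  have "emeasure (clocks l m) N \<le> ennreal (expected_reward l m 0 1 f n i j)" for n
  proof -
    have "emeasure (clocks l m) N = (\<integral>\<^sup>+ \<omega>. indicator N \<omega> \<partial>clocks l m)"
      by simp
    also have "\<dots> \<le> (\<integral>\<^sup>+ \<omega>. reward 0 1 f n (i, j) \<omega> \<partial>clocks l m)"
      by (intro nn_integral_mono) (auto simp: alive split: split_indicator)
    finally show ?thesis
      by (simp add: nn_integral_reward)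
  qed
  then have "emeasure (clocks l m) N \<le> ennreal 0"
    by (intro LIMSEQ_le_const[OF tendsto_ennrealI[OF vanish]]) auto
  then have "N \<in> null_sets (clocks l m)"
    by (intro null_setsI) auto
  then show ?thesis
    by (rule AE_I') (auto simp: N_def)
qed

text \<open>With \<open>N\<close> the first absorption index, the infimum is attained at
  \<open>N\<close> because jump times do not decrease. The truncated reward sums the sojourns before
  both \<open>n\<close> and \<open>N\<close>, so it is largest at \<open>n = N\<close>.\<close>

lemma emptying_time_eq_SUP_reward:
  assumes nonneg: "\<forall>k. 0 \<le> min (fst (\<omega> !! k)) (snd (\<omega> !! k))"
    and "\<exists>n. fst (jump_chain f (i, j) \<omega> n) = 0"
  shows "emptying_time f i j \<omega> = (SUP n. reward 1 0 f n (i, j) \<omega>)"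
proof -
  let ?alive = "\<lambda>n. fst (jump_chain f (i, j) \<omega> n) \<noteq> 0"
  define N where "N = (LEAST n. \<not> ?alive n)"
  have N: "\<not> ?alive N"
    unfolding N_def using assms(2) by (auto intro: LeastI_ex)
  have absorbed_iff: "fst (jump_chain f (i, j) \<omega> k) = 0 \<longleftrightarrow> N \<le> k" for k
    using jump_chain_absorbed[of N k f "(i, j)" \<omega>] N Least_le[of "\<lambda>n. \<not> ?alive n" k]
    by (auto simp: N_def)
  have mono: "jump_time \<omega> N \<le> jump_time \<omega> n" if "N \<le> n" for n
    unfolding jump_time_def using nonneg that by (intro sum_mono2) auto
  have "emptying_time f i j \<omega> = ennreal (jump_time \<omega> N)"
    unfolding emptying_time_def
  proof (rule antisym)
    show "(INF n\<in>{n. fst (jump_chain f (i, j) \<omega> n) = 0}. ennreal (jump_time \<omega> n))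
        \<le> ennreal (jump_time \<omega> N)"
      using N by (intro INF_lower) auto
    show "ennreal (jump_time \<omega> N)
        \<le> (INF n\<in>{n. fst (jump_chain f (i, j) \<omega> n) = 0}. ennreal (jump_time \<omega> n))"
      by (intro INF_greatest ennreal_leI mono) (simp add: absorbed_iff)
  qed
  also have "\<dots> = (SUP n. reward 1 0 f n (i, j) \<omega>)"
  proof (rule antisym)
    have "ennreal (jump_time \<omega> N) = (\<Sum>k<N. ennreal (min (fst (\<omega> !! k)) (snd (\<omega> !! k))))"
      unfolding jump_time_def using nonneg by (intro sum_ennreal[symmetric]) auto
    also have "\<dots> = reward 1 0 f N (i, j) \<omega>"
      by (simp add: reward_def absorbed_iff)
    finally show "ennreal (jump_time \<omega> N) \<le> (SUP n. reward 1 0 f n (i, j) \<omega>)"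
      by (auto intro: SUP_upper2)
    show "(SUP n. reward 1 0 f n (i, j) \<omega>) \<le> ennreal (jump_time \<omega> N)"
    proof (rule SUP_least)
      fix n
      have "reward 1 0 f n (i, j) \<omega>
          = (\<Sum>k\<in>{..<n} \<inter> {..<N}. ennreal (min (fst (\<omega> !! k)) (snd (\<omega> !! k))))"
        unfolding reward_def
        by (auto simp: absorbed_iff sum.inter_restrict not_less intro!: sum.cong)
      also have "\<dots> = ennreal (\<Sum>k\<in>{..<n} \<inter> {..<N}. min (fst (\<omega> !! k)) (snd (\<omega> !! k)))"
        using nonneg by (intro sum_ennreal) auto
      also have "\<dots> \<le> ennreal (jump_time \<omega> N)"
        unfolding jump_time_def using nonneg by (intro ennreal_leI sum_mono2) auto
      finally show "reward 1 0 f n (i, j) \<omega> \<le> ennreal (jump_time \<omega> N)" .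
    qed
  qed
  finally show ?thesis .
qed

lemma incseq_reward: "incseq (\<lambda>n. reward a 0 f n s)"
  by (intro incseq_SucI le_funI) (auto simp: reward_def)

lemma expected_emptying_time_eq_SUP:
  "expected_emptying_time l m f i j = (SUP n. ennreal (expected_reward l m 1 0 f n i j))"
proof -
  have "expected_emptying_time l m f i j = (\<integral>\<^sup>+ \<omega>. (SUP n. reward 1 0 f n (i, j) \<omega>) \<partial>clocks l m)"
    unfolding expected_emptying_time_def
    by (intro nn_integral_cong_AE, use AE_clocks_nonneg AE_absorbed[of f i j] in eventually_elim)
       (rule emptying_time_eq_SUP_reward)
  also have "\<dots> = (SUP n. \<integral>\<^sup>+ \<omega>. reward 1 0 f n (i, j) \<omega> \<partial>clocks l m)"
    by (rule nn_integral_monotone_convergence_SUP[OF incseq_reward]) simp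
  finally show ?thesis
    by (simp add: nn_integral_reward)
qed

text \<open>The truncated means stay below \<open>t\<close>. In the difference the constant
  \<open>1 / (l + m)\<close> cancels, so the gap follows the killed walk and vanishes by
  \<open>absorbed_walk_vanishes\<close>; the truncated means therefore increase to
  \<open>t\<close>.\<close>

lemma expected_emptying_time_unique:
  fixes t :: "nat \<Rightarrow> nat \<Rightarrow> real"
  assumes nonneg: "\<And>i j. 0 \<le> t i j"
    and absorbed: "\<And>j. t 0 j = 0"
    and step: "\<And>i j. 0 < i \<Longrightarrow> t i j = 1 / (l + m) + m / (l + m) * t (i - 1) j
      + l / (l + m) * case_prod t (arrival_move f i j)"
    and linear: "\<And>i j. t i j \<le> C * real i" and "0 \<le> C"
  shows "expected_emptying_time l m f i j = ennreal (t i j)"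
proof -
  let ?T = "expected_reward l m 1 0 f"
  have le: "?T n i j \<le> t i j" for n i j
  proof (induction n arbitrary: i j)
    case 0
    then show ?case by (simp add: nonneg)
  next
    case (Suc n)
    show ?case
    proof (cases "i = 0")
      case False
      have "case_prod (?T n) (arrival_move f i j) \<le> case_prod t (arrival_move f i j)"
        using Suc by (simp add: case_prod_beta)
      from first_step_mono[OF Suc this] show ?thesis
        using False by (simp add: expected_reward_step step)
    qed (simp add: absorbed)
  qed
  have "(\<lambda>n. t i j - ?T n i j) \<longlonglongrightarrow> 0"
  proof (rule absorbed_walk_vanishes[where f = f and C = C])
    show "0 \<le> t i j - ?T n i j" for n i j
      using le by simp
    show "t 0 j - ?T n 0 j = 0" for n j
      by (simp add: absorbed)
    show "t i j - ?T (Suc n) i j = m / (l + m) * (t (i - 1) j - ?T n (i - 1) j)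
        + l / (l + m) * (case arrival_move f i j of (i, j) \<Rightarrow> t i j - ?T n i j)"
      if "0 < i" for n i j
      using that by (simp add: expected_reward_step step case_prod_beta right_diff_distrib diff_divide_distrib)
    show "t i j - ?T 0 i j \<le> C * real i" for i j
      using linear by simp
  qed fact
  from tendsto_diff[OF tendsto_const[of "t i j"] this] have "(\<lambda>n. ?T n i j) \<longlonglongrightarrow> t i j"
    by simp
  then have lim: "(\<lambda>n. ennreal (?T n i j)) \<longlonglongrightarrow> ennreal (t i j)"
    by (rule tendsto_ennrealI)
  have "incseq (\<lambda>n. ennreal (?T n i j))"
    using incseq_reward[of 1 f "(i, j)"]
    by (auto simp: nn_integral_reward[symmetric] incseq_def le_fun_def intro!: nn_integral_mono)
  from LIMSEQ_unique[OF LIMSEQ_SUP[OF this] lim] show ?thesis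
    by (simp add: expected_emptying_time_eq_SUP)
qed

end

section \<open>Bounds and monotonicity of the iterates\<close>

locale polling_costs = stable_queue +
  fixes c d :: real
  assumes c_pos: "0 < c" and d_nonneg: "0 \<le> d"
begin

abbreviation \<tau> :: "nat \<Rightarrow> nat \<Rightarrow> nat \<Rightarrow> real" where "\<tau> \<equiv> tau_iter l m c d"

lemma best_move_cases:
  obtains "best_move m c d t i j = (i + 1, j)" | "best_move m c d t i j = (i, j + 1)"
  by (cases "c * real i / m < d * t i (j + 1) + c * real j / m") (auto simp: best_move_def)

lemma tau_iter_zero [simp]: "\<tau> n 0 j = 0"
  by (cases n) (auto simp: tau_iter.simps(2))

lemma tau_iter_step:
  "0 < i \<Longrightarrow> \<tau> (Suc n) i j = 1 / (l + m) + m / (l + m) * \<tau> n (i - 1) j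
    + l / (l + m) * case_prod (\<tau> n) (best_move m c d (\<tau> n) i j)"
  by (simp add: tau_iter.simps(2))

lemma tau_iter_nonneg: "0 \<le> \<tau> n i j"
  using arrival_pos service_pos
  by (induction n arbitrary: i j) (auto simp: tau_iter.simps(2) split: prod.split)

text \<open>The bound solves the first-step equation in which every arrival joins the busy queue,
  and it is increasing in \<open>i\<close>, so joining the idle queue can only do better.\<close>

lemma tau_iter_le: "\<tau> n i j \<le> real i / (m - l)"
proof (induction n arbitrary: i j)
  case 0
  then show ?case
    using arrival_pos arrival_less_service by (auto intro!: divide_left_mono mult_pos_pos)
next
  case (Suc n)
  show ?case
  proof (cases "i = 0")
    case False
    have "case_prod (\<tau> n) (best_move m c d (\<tau> n) i j) \<le> real (i + 1) / (m - l)"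
    proof (cases rule: best_move_cases[of "\<tau> n" i j])
      case 1
      show ?thesis unfolding 1 using Suc[of "i + 1" j] by simp
    next
      case 2
      have "\<tau> n i (j + 1) \<le> real i / (m - l)" by (rule Suc)
      also have "\<dots> \<le> real (i + 1) / (m - l)"
        using arrival_less_service by (intro divide_right_mono) auto
      finally show ?thesis unfolding 2 by simp
    qed
    moreover have "\<tau> n (i - 1) j \<le> real (i - 1) / (m - l)" by (rule Suc)
    ultimately have "\<tau> (Suc n) i j \<le> 1 / (l + m) + m / (l + m) * (real (i - 1) / (m - l))
        + l / (l + m) * (real (i + 1) / (m - l))"
      using False by (simp only: tau_iter_step neq0_conv first_step_mono)
    also have "\<dots> = real i / (m - l)"
      using False arrival_pos arrival_less_service
      by (simp add: of_nat_diff divide_simps) (simp add: algebra_simps)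
    finally show ?thesis .
  qed simp
qed

text \<open>
  Both possible targets of an arrival in \<open>(i + 1, j)\<close> dominate both targets of an arrival in
  \<open>(i, j + 1)\<close>, so this holds whatever the decisions are.
\<close>

lemma tau_iter_transfer: "\<tau> n i (j + 1) \<le> \<tau> n (i + 1) j"
proof (induction n arbitrary: i j)
  case 0
  then show ?case using service_pos by (simp add: divide_right_mono)
next
  case (Suc n)
  show ?case
  proof (cases "i = 0")
    case True
    then show ?thesis using tau_iter_nonneg[of "Suc n"] by simp
  next
    case False
    \<comment> \<open>By induction, \<open>(i + 1, j + 1)\<close> is the larger target of an arrival
      in \<open>(i, j + 1)\<close> and the smaller target of one in
      \<open>(i + 1, j)\<close>.\<close>
    have 1: "case_prod (\<tau> n) (best_move m c d (\<tau> n) i (j + 1)) \<le> \<tau> n (i + 1) (j + 1)"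
      using Suc[of i "j + 1"] by (cases rule: best_move_cases[of "\<tau> n" i "j + 1"]) auto
    have 2: "\<tau> n (i + 1) (j + 1) \<le> case_prod (\<tau> n) (best_move m c d (\<tau> n) (i + 1) j)"
      using Suc[of "i + 1" j] by (cases rule: best_move_cases[of "\<tau> n" "i + 1" j]) auto
    have "\<tau> n (i - 1) (j + 1) \<le> \<tau> n i j"
      using Suc[of "i - 1" j] False by simp
    from first_step_mono[OF this order_trans[OF 1 2]] show ?thesis
      using False by (simp add: tau_iter_step)
  qed
qed

text \<open>Since \<open>d\<close> is nonnegative, raising \<open>t\<close> only raises the cost of
  the idle queue. Along increasing iterates a decision for the busy queue is thus never
  revoked.\<close>

lemma best_move_mono:
  assumes "t i (j + 1) \<le> t' i (j + 1)" and "best_move m c d t i j = (i + 1, j)"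
  shows "best_move m c d t' i j = (i + 1, j)"
  using mult_left_mono[OF assms(1) d_nonneg] assms(2)
  by (auto simp: best_move_def split: if_splits)

text \<open>The start \<open>i / m\<close> solves the first-step equation of always joining the idle
  queue, and either move has at least that value. Afterwards a decision can only change from idle to
  busy, which does not lower the value by \<open>tau_iter_transfer\<close>.\<close>

lemma tau_iter_Suc: "\<tau> n i j \<le> \<tau> (Suc n) i j"
proof (induction n arbitrary: i j)
  case 0
  show ?case
  proof (cases "i = 0")
    case False
    have "case_prod (\<tau> 0) (best_move m c d (\<tau> 0) i j) \<ge> real i / m"
      using service_pos by (cases rule: best_move_cases[of "\<tau> 0" i j]) (auto intro: divide_right_mono)
    from first_step_mono[OF order_refl this]
    have "1 / (l + m) + m / (l + m) * \<tau> 0 (i - 1) j + l / (l + m) * (real i / m) \<le> \<tau> (Suc 0) i j"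
      using False by (simp only: tau_iter_step neq0_conv)
    moreover have "1 / (l + m) + m / (l + m) * \<tau> 0 (i - 1) j + l / (l + m) * (real i / m)
        = real i / m"
      using False arrival_pos service_pos
      by (simp add: of_nat_diff divide_simps) (simp add: algebra_simps)
    ultimately show ?thesis by simp
  qed simp
next
  case (Suc n)
  show ?case
  proof (cases "i = 0")
    case False
    have "case_prod (\<tau> n) (best_move m c d (\<tau> n) i j)
        \<le> case_prod (\<tau> (Suc n)) (best_move m c d (\<tau> (Suc n)) i j)"
    proof (cases rule: best_move_cases[of "\<tau> n" i j])
      case 1
      show ?thesis
        unfolding 1 best_move_mono[where t = "\<tau> n" and t' = "\<tau> (Suc n)", OF Suc 1] using Suc[of "i + 1" j] by simp
    next
      case 2
      have "\<tau> n i (j + 1) \<le> \<tau> (Suc n) i (j + 1)" by (rule Suc)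
      then show ?thesis
        unfolding 2 using tau_iter_transfer[of "Suc n" i j]
        by (cases rule: best_move_cases[of "\<tau> (Suc n)" i j]) auto
    qed
    from first_step_mono[OF Suc this] show ?thesis
      using False by (simp only: tau_iter_step neq0_conv)
  qed simp
qed

lemma incseq_tau_iter: "incseq (\<lambda>n. \<tau> n i j)"
  by (intro incseq_SucI tau_iter_Suc)

section \<open>The limit and its policy\<close>

definition tau_lim :: "nat \<Rightarrow> nat \<Rightarrow> real" where
  "tau_lim i j = lim (\<lambda>n. \<tau> n i j)"

lemma tau_iter_tendsto: "(\<lambda>n. \<tau> n i j) \<longlonglongrightarrow> tau_lim i j"
  unfolding tau_lim_def convergent_LIMSEQ_iff[symmetric]
  using incseq_tau_iter tau_iter_nonneg tau_iter_le
  by (intro Bseq_mono_convergent BseqI'[where K = "real i / (m - l)"]) (auto dest: incseqD)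

lemma tau_iter_le_tau_lim: "\<tau> n i j \<le> tau_lim i j"
  by (rule incseq_le[OF incseq_tau_iter tau_iter_tendsto])

lemma delta_iter_eventually:
  "\<forall>\<^sub>F n in sequentially. delta_iter l m c d n i j = best_move m c d tau_lim i j"
proof (cases "\<exists>n. best_move m c d (\<tau> n) i j = (i + 1, j)")
  case True
  then obtain n where n: "best_move m c d (\<tau> n) i j = (i + 1, j)" by auto
  have "best_move m c d (\<tau> k) i j = (i + 1, j)" if "n \<le> k" for k
    by (rule best_move_mono[OF _ n]) (rule incseqD[OF incseq_tau_iter that])
  \<comment> \<open>Limits need not preserve a strict inequality; this one survives because the
    limit dominates the iterate \<open>\<tau> n\<close>.\<close>
  moreover have "best_move m c d tau_lim i j = (i + 1, j)"
    by (rule best_move_mono[where t = "\<tau> n" and t' = tau_lim, OF tau_iter_le_tau_lim n])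
  ultimately show ?thesis
    by (auto simp: delta_iter_def eventually_sequentially)
next
  case False
  then have idle: "d * \<tau> n i (j + 1) + c * real j / m \<le> c * real i / m" for n
    by (auto simp: best_move_def not_less split: if_splits)
  have "d * tau_lim i (j + 1) + c * real j / m \<le> c * real i / m"
    using idle by (intro LIMSEQ_le_const2[where X="\<lambda>n. d * \<tau> n i (j + 1) + c * real j / m"]
        tendsto_intros tau_iter_tendsto) auto
  with idle show ?thesis
    by (auto simp: delta_iter_def best_move_def not_less[symmetric])
qed

text \<open>The move in the recursion varies with \<open>n\<close>. Once it has reached its eventual
  value, all terms converge separately.\<close>

lemma tau_lim_step:
  assumes "0 < i"
  shows "tau_lim i j = 1 / (l + m) + m / (l + m) * tau_lim (i - 1) j
      + l / (l + m) * case_prod tau_lim (best_move m c d tau_lim i j)"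
proof -
  have "(\<lambda>n. case_prod (\<tau> n) s) \<longlonglongrightarrow> case_prod tau_lim s" for s
    by (cases s) (simp add: tau_iter_tendsto)
  then have "(\<lambda>n. 1 / (l + m) + m / (l + m) * \<tau> n (i - 1) j
        + l / (l + m) * case_prod (\<tau> n) (best_move m c d tau_lim i j))
      \<longlonglongrightarrow> 1 / (l + m) + m / (l + m) * tau_lim (i - 1) j
        + l / (l + m) * case_prod tau_lim (best_move m c d tau_lim i j)"
    by (intro tendsto_intros tau_iter_tendsto)
  moreover have "\<forall>\<^sub>F n in sequentially. 1 / (l + m) + m / (l + m) * \<tau> n (i - 1) j
        + l / (l + m) * case_prod (\<tau> n) (best_move m c d tau_lim i j) = \<tau> (Suc n) i j"
    using delta_iter_eventually[of i j] by eventually_elim (use assms in \<open>simp add: delta_iter_def tau_iter_step\<close>)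
  ultimately have "(\<lambda>n. \<tau> (Suc n) i j) \<longlonglongrightarrow> 1 / (l + m) + m / (l + m) * tau_lim (i - 1) j
        + l / (l + m) * case_prod tau_lim (best_move m c d tau_lim i j)"
    by (rule Lim_transform_eventually)
  from LIMSEQ_unique[OF LIMSEQ_Suc[OF tau_iter_tendsto] this] show ?thesis .
qed

definition limit_policy :: "nat \<Rightarrow> nat \<Rightarrow> queue" where
  "limit_policy i j = (if best_move m c d tau_lim i j = (i + 1, j) then Busy else Idle)"

lemma arrival_move_limit_policy: "arrival_move limit_policy i j = best_move m c d tau_lim i j"
  by (cases rule: best_move_cases[of tau_lim i j]) (auto simp: arrival_move_def limit_policy_def)

lemma tau_lim_nonneg: "0 \<le> tau_lim i j"
  using tau_iter_nonneg tau_iter_le_tau_lim by (rule order_trans)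

text \<open>An arrival under \<open>limit_policy\<close> makes the best move for
  \<open>tau_lim\<close>, so \<open>tau_lim_step\<close> is the first-step equation of this policy
  and uniqueness applies.\<close>

lemma expected_emptying_time_limit_policy:
  "expected_emptying_time l m limit_policy i j = ennreal (tau_lim i j)"
proof (rule expected_emptying_time_unique[where C = "1 / (m - l)"])
  show "tau_lim 0 j = 0" for j
    by (simp add: tau_lim_def)
  show "tau_lim i j \<le> 1 / (m - l) * real i" for i j
    using tau_iter_le by (intro LIMSEQ_le_const2[OF tau_iter_tendsto]) auto
qed (use arrival_less_service in \<open>auto simp: tau_lim_nonneg arrival_move_limit_policy tau_lim_step\<close>)

text \<open>With the emptying time identified as \<open>tau_lim\<close>, optimality is the criterion
  in \<open>best_move\<close>. All quantities are nonnegative, so comparing them in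
  \<open>ennreal\<close> or in the reals is the same.\<close>

lemma individually_optimal_limit_policy: "individually_optimal l m c d limit_policy"
  unfolding individually_optimal_def expected_emptying_time_limit_policy
proof (intro allI impI)
  fix i j :: nat
  have "ennreal d * ennreal (tau_lim i (j + 1)) + ennreal (c * real j / m)
      = ennreal (d * tau_lim i (j + 1) + c * real j / m)"
    using c_pos d_nonneg service_pos tau_lim_nonneg
    by (simp add: ennreal_mult)
  then show "limit_policy i j = Busy \<longleftrightarrow> ennreal (c * real i / m)
      < ennreal d * ennreal (tau_lim i (j + 1)) + ennreal (c * real j / m)"
    using c_pos service_pos by (simp add: limit_policy_def best_move_def ennreal_less_iff)
qed

end

theorem theorem5p2:
  fixes l m c d :: real
  assumes "0 < l" and "l < m" and "c > 0" and "d \<ge> 0"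
  shows "\<exists>(\<tau> :: nat \<Rightarrow> nat \<Rightarrow> real) (\<delta> :: nat \<Rightarrow> nat \<Rightarrow> nat \<times> nat) (f :: nat \<Rightarrow> nat \<Rightarrow> queue).
    (\<forall>i\<ge>1. \<forall>j.
       (\<lambda>n. tau_iter l m c d n i j) \<longlonglongrightarrow> \<tau> i j \<and>
       (\<forall>\<^sub>F n in sequentially. delta_iter l m c d n i j = \<delta> i j) \<and>
       (f i j = Busy \<longleftrightarrow> \<delta> i j = (i + 1, j)) \<and>
       (f i j = Idle \<longleftrightarrow> \<delta> i j = (i, j + 1)) \<and>
       ennreal (\<tau> i j) = expected_emptying_time l m f i j) \<and>
    individually_optimal l m c d f"
proof -
  interpret polling_costs l m c d
    by unfold_locales fact+
  show ?thesis
  proof (intro exI[of _ tau_lim] exI[of _ "best_move m c d tau_lim"] exI[of _ limit_policy] conjI allI impI)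
    show "limit_policy i j = Idle \<longleftrightarrow> best_move m c d tau_lim i j = (i, j + 1)" for i j
      by (cases rule: best_move_cases[of tau_lim i j]) (auto simp: limit_policy_def)
  qed (simp_all add: tau_iter_tendsto delta_iter_eventually limit_policy_def
      expected_emptying_time_limit_policy individually_optimal_limit_policy)
qed

end
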